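(* Let $n\ge 2$, $m\ge 1$ and $d\in\{1,\dots,n-1\}$ be integers, and let $M(n,d)=\{k\ge 1 : \gcd(\ell,k)\le d \text{ for all integers } \ell \text{ with } 1<\ell\le n\}$. If $m\notin M(n,d)$, then there is no symmetric algorithm that solves $d$-election (participation not required) for $n$ processes communicating through $m$ anonymous read-modify-write (RMW) registers.
   Context: System. There are $n$ asynchronous deterministic processes $p_1,\dots,p_n$ and $m$ shared atomic registers $R[1],\dots,R[m]$. An execution is an interleaving of atomic steps; in each step one process performs one operation on one register and updates its local state. Processes do not crash: every participating process that has not yet returned keeps taking steps; otherwise the interleaving is arbitrary. Algorithms may depend on $n,m,d$. RMW registers. The operations on a register $X$ are read, write, and $\mathsf{compare\&swap}(X,\mathrm{old},\mathrm{new})$, which atomically does the following: if $X=\mathrm{old}$ it assigns $\mathrm{new}$ to $X$ and returns true, otherwise it leaves $X$ unchanged and returns false. Anonymous memory. An adversary chooses, for each process $p_i$, a permutation $f_i$ of $\{1,\dots,m\}$, unknown to all the processes; when $p_i$ uses the name $R[x]$ it accesses the register $R[f_i(x)]$. All registers are initialized to the same default value, which is not a process identity. Symmetric algorithm. The processes have distinct identities and run the same code. Identities can be stored, written to and read from registers, and compared with each other for equality only; there is no order on identities, and they cannot be used for anything else (e.g. to index arrays). Thus, the behaviour of the algorithm commutes with any renaming (permutation) of the identities. $d$-election. Each participating process invokes an operation $\mathsf{elect}()$ (once), which returns either "leader" or "not leader"; a process that returns "leader" is said to be elected. An algorithm solves $d$-election if in every execution, for every choice of the permutations $f_i$, every participating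 process eventually returns, and at least one and at most $d$ processes are elected. "Participation not required" means that this must hold for every nonempty subset of the $n$ processes as the set of participating processes. *)

theory Defs
  imports Main "HOL-Combinatorics.Permutations"
begin

definition M :: "nat \<Rightarrow> nat \<Rightarrow> nat set" where
  "M n d = {k. k \<ge> 1 \<and> (\<forall>l. 1 < l \<and> l \<le> n \<longrightarrow> gcd l k \<le> d)}"

datatype decision = Leader | NotLeader

text \<open>
  What a process does next, as determined by its local state. Register names are local:
  name \<open>x\<close> used by process \<open>p\<close> denotes the register \<open>f p x\<close>.
  \<open>Return\<close> is final: a process in such a state has returned and takes no further steps.
\<close>
datatype 'v action =
    Read nat
  | Write nat 'v
  | CompareSwap nat 'v 'v
  | Return decision

datatype 'v response = ReadResult 'v | WriteDone | CasResult bool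

text \<open>
  The common code of all processes, a deterministic automaton with local states \<open>'s\<close>.
  The only parameter of the code is the identity of the process executing it. Register
  contents \<open>'v\<close> are opaque: they may be identities or any data built from identities.
\<close>
record ('id, 's, 'v) algorithm =
  initial :: "'id \<Rightarrow> 's"
  action :: "'s \<Rightarrow> 'v action"
  update :: "'s \<Rightarrow> 'v response \<Rightarrow> 's"
  default_value :: 'v

fun register_name_ok :: "nat \<Rightarrow> 'v action \<Rightarrow> bool" where
  "register_name_ok m (Read x) \<longleftrightarrow> x \<in> {1..m}"
| "register_name_ok m (Write x v) \<longleftrightarrow> x \<in> {1..m}"
| "register_name_ok m (CompareSwap x old new) \<longleftrightarrow> x \<in> {1..m}"
| "register_name_ok m (Return b) \<longleftrightarrow> True"

definition uses_registers :: "nat \<Rightarrow> ('id, 's, 'v) algorithm \<Rightarrow> bool" where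
  "uses_registers m A \<longleftrightarrow> (\<forall>s. register_name_ok m (action A s))"

text \<open>
  The permutations of the set \<open>I\<close> of identities act on a type of data by replacing
  all identities occurring in a datum. How identities occur in data is left open; only the
  laws of a group action are required.
\<close>
definition renaming_action :: "'id set \<Rightarrow> (('id \<Rightarrow> 'id) \<Rightarrow> 'a \<Rightarrow> 'a) \<Rightarrow> bool" where
  "renaming_action I ren \<longleftrightarrow>
     (\<forall>x. ren id x = x) \<and>
     (\<forall>\<pi> \<rho> x. \<pi> permutes I \<longrightarrow> \<rho> permutes I \<longrightarrow> ren (\<pi> \<circ> \<rho>) x = ren \<pi> (ren \<rho> x))"

text \<open>
  The behaviour commutes with every renaming of the identities. Register names, decisions
  and results of compare-and-swap are not affected by a renaming, so that they can depend on
  identities only through equality tests. An identity stored in a register is moved by a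
  renaming whereas the default value is not, so the default value is not an identity.
\<close>
definition symmetric :: "'id set \<Rightarrow> ('id, 's, 'v) algorithm \<Rightarrow> bool" where
  "symmetric I A \<longleftrightarrow>
     (\<exists>rens renv. renaming_action I rens \<and> renaming_action I renv \<and>
        (\<forall>\<pi>. \<pi> permutes I \<longrightarrow>
           renv \<pi> (default_value A) = default_value A \<and>
           (\<forall>i\<in>I. initial A (\<pi> i) = rens \<pi> (initial A i)) \<and>
           (\<forall>s. action A (rens \<pi> s) = map_action (renv \<pi>) (action A s)) \<and>
           (\<forall>s r. update A (rens \<pi> s) (map_response (renv \<pi>) r) = rens \<pi> (update A s r))))"

record ('s, 'v) config =
  state :: "nat \<Rightarrow> 's"
  mem :: "nat \<Rightarrow> 'v"

definition init_config :: "(nat \<Rightarrow> 'id) \<Rightarrow> ('id, 's, 'v) algorithm \<Rightarrow> ('s, 'v) config" where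
  "init_config ident A =
     \<lparr>state = (\<lambda>p. initial A (ident p)), mem = (\<lambda>_. default_value A)\<rparr>"

fun perform :: "'v action \<Rightarrow> (nat \<Rightarrow> nat) \<Rightarrow> (nat \<Rightarrow> 'v) \<Rightarrow> ('v response \<times> (nat \<Rightarrow> 'v)) option" where
  "perform (Read x) g R = Some (ReadResult (R (g x)), R)"
| "perform (Write x v) g R = Some (WriteDone, R(g x := v))"
| "perform (CompareSwap x old new) g R =
     (if R (g x) = old then Some (CasResult True, R(g x := new)) else Some (CasResult False, R))"
| "perform (Return b) g R = None"

definition step ::
  "('id, 's, 'v) algorithm \<Rightarrow> (nat \<Rightarrow> nat \<Rightarrow> nat) \<Rightarrow> nat \<Rightarrow> ('s, 'v) config \<Rightarrow> ('s, 'v) config" where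
  "step A f p c =
     (case perform (action A (state c p)) (f p) (mem c) of
        None \<Rightarrow> c
      | Some (r, R) \<Rightarrow> \<lparr>state = (state c)(p := update A (state c p) r), mem = R\<rparr>)"

text \<open>
  The configuration after \<open>t\<close> entries of the schedule. Schedules are infinite; scheduling
  a process that has already returned has no effect, so finite executions are included.
\<close>
primrec run ::
  "(nat \<Rightarrow> 'id) \<Rightarrow> ('id, 's, 'v) algorithm \<Rightarrow> (nat \<Rightarrow> nat \<Rightarrow> nat) \<Rightarrow> (nat \<Rightarrow> nat) \<Rightarrow> nat
    \<Rightarrow> ('s, 'v) config" where
  "run ident A f sched 0 = init_config ident A"
| "run ident A f sched (Suc t) = step A f (sched t) (run ident A f sched t)"

definition returned :: "('id, 's, 'v) algorithm \<Rightarrow> ('s, 'v) config \<Rightarrow> nat \<Rightarrow> decision \<Rightarrow> bool" where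
  "returned A c p b \<longleftrightarrow> action A (state c p) = Return b"

definition execution ::
  "(nat \<Rightarrow> 'id) \<Rightarrow> ('id, 's, 'v) algorithm \<Rightarrow> nat set \<Rightarrow> (nat \<Rightarrow> nat \<Rightarrow> nat) \<Rightarrow> (nat \<Rightarrow> nat) \<Rightarrow> bool" where
  "execution ident A P f sched \<longleftrightarrow>
     (\<forall>t. sched t \<in> P) \<and>
     (\<forall>p\<in>P. \<forall>t. (\<nexists>b. returned A (run ident A f sched t) p b) \<longrightarrow> (\<exists>t'\<ge>t. sched t' = p))"

definition elected ::
  "(nat \<Rightarrow> 'id) \<Rightarrow> ('id, 's, 'v) algorithm \<Rightarrow> nat set \<Rightarrow> (nat \<Rightarrow> nat \<Rightarrow> nat) \<Rightarrow> (nat \<Rightarrow> nat) \<Rightarrow> nat set" where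
  "elected ident A P f sched = {p \<in> P. \<exists>t. returned A (run ident A f sched t) p Leader}"

definition solves_election ::
  "nat \<Rightarrow> nat \<Rightarrow> nat \<Rightarrow> (nat \<Rightarrow> 'id) \<Rightarrow> ('id, 's, 'v) algorithm \<Rightarrow> bool" where
  "solves_election n m d ident A \<longleftrightarrow>
     (\<forall>P f sched.
        P \<noteq> {} \<and> P \<subseteq> {1..n} \<and> (\<forall>p\<in>{1..n}. f p permutes {1..m}) \<and> execution ident A P f sched \<longrightarrow>
          (\<forall>p\<in>P. \<exists>t b. returned A (run ident A f sched t) p b) \<and>
          1 \<le> card (elected ident A P f sched) \<and> card (elected ident A P f sched) \<le> d)"

end

theory Submission
  imports Defs
begin

text \<open>
  Let \<open>g = gcd l m > d\<close> be a witness of \<open>m \<notin> M n d\<close>, and let only the processes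
  \<open>1, \<dots>, g\<close> participate. Arrange the registers in a ring and let the naming of process \<open>p\<close> be the
  rotation by \<open>p * (m div g)\<close>. In a round-robin schedule the processes access \<open>g\<close> distinct
  registers in every round, so a round acts like one simultaneous step. Hence after
  every round the configuration is invariant under shifting the participating processes cyclically,
  rotating the registers by \<open>m div g\<close> and renaming the identities accordingly. All \<open>g\<close> processes
  therefore return the same decision, so that \<open>0\<close> or \<open>g > d\<close> of them are elected.
\<close>

section \<open>Rotations of a ring\<close>

text \<open>The ring is numbered from 1, hence the shift by one around \<open>mod\<close>; points
  outside are fixed, as \<open>permutes\<close> demands. Besides moving registers, it provides the
  cyclic shift \<open>rotation g 1\<close> of the processes.\<close>

definition rotation :: "nat \<Rightarrow> nat \<Rightarrow> nat \<Rightarrow> nat" where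
  "rotation m a y = (if y \<in> {1..m} then (y - 1 + a) mod m + 1 else y)"

lemma rotation_Suc: "z < m \<Longrightarrow> rotation m a (Suc z) = Suc ((z + a) mod m)"
  by (simp add: rotation_def)

lemma in_ring_cases:
  fixes y m :: nat
  obtains "y \<notin> {1..m}" | z where "z < m" "y = Suc z"
  by (cases y) (auto simp: Suc_le_eq)

lemma rotation_in: "rotation m a y \<in> {1..m} \<longleftrightarrow> y \<in> {1..m}"
  by (cases y m rule: in_ring_cases) (auto simp: rotation_def Suc_le_eq)

lemma rotation_rotation: "rotation m a (rotation m b y) = rotation m (a + b) y"
  by (cases y m rule: in_ring_cases)
    (auto simp: rotation_Suc mod_simps ac_simps, auto simp: rotation_def)

lemma rotation_full: "rotation m (m * k) = id"
proof
  fix y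
  show "rotation m (m * k) y = id y"
    by (cases y m rule: in_ring_cases) (auto simp: rotation_Suc, auto simp: rotation_def)
qed

lemma rotation_add_full: "rotation m (a + m) = rotation m a"
  using rotation_rotation[of m a "m * 1"] rotation_full[of m 1] by (auto simp: fun_eq_iff)

lemma rotation_permutes: "rotation m a permutes {1..m}"
proof (rule bij_imp_permutes)
  \<comment> \<open>Offsets are natural numbers, so the inverse of the rotation by \<open>a\<close>
    is written as the rotation by \<open>(m - 1) * a\<close>: together they make full turns.\<close>
  have "(m - 1) * a + a = m * a" if "m > 0"
    using that by (cases m) simp_all
  then have inverse: "rotation m ((m - 1) * a) (rotation m a y) = y"
    "rotation m a (rotation m ((m - 1) * a) y) = y" for y
    using rotation_full[of m a]
    by (cases "m = 0"; simp add: rotation_rotation add.commute; simp add: rotation_def)+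
  show "bij_betw (rotation m a) {1..m} {1..m}"
    by (rule bij_betw_byWitness[where f' = "rotation m ((m - 1) * a)"])
      (simp_all only: inverse rotation_in image_subset_iff, simp_all)
qed (auto simp: rotation_def)

text \<open>The offsets of \<open>p < q\<close> differ by \<open>(q - p) * k\<close> with
  \<open>q - p < g\<close>, which is no multiple of \<open>g * k\<close>. Hence processes using the
  same name reach different registers.\<close>

lemma inj_on_rotation_multiples:
  assumes "x \<in> {1..g * k}"
  shows "inj_on (\<lambda>p. rotation (g * k) (p * k) x) {1..g}"
proof (rule linorder_inj_onI)
  fix p q
  assume pq: "p < q" "p \<in> {1..g}" "q \<in> {1..g}"
  have k: "k > 0" using assms by (cases k) auto
  show "rotation (g * k) (p * k) x \<noteq> rotation (g * k) (q * k) x"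
  proof
    assume "rotation (g * k) (p * k) x = rotation (g * k) (q * k) x"
    then have "(x - 1 + q * k) mod (g * k) = (x - 1 + p * k) mod (g * k)"
      using assms by (simp add: rotation_def)
    then have "g * k dvd (x - 1 + q * k) - (x - 1 + p * k)"
      by (rule mod_eq_dvd_iff_nat[THEN iffD1, rotated]) (use pq in simp)
    also have "(x - 1 + q * k) - (x - 1 + p * k) = (q - p) * k"
      by (simp add: diff_mult_distrib)
    finally have "g dvd q - p" using k by simp
    then have "g \<le> q - p" using pq by (simp add: dvd_imp_le)
    then show False using pq by auto
  qed
qed auto

section \<open>Operations as functions of the accessed register\<close>

text \<open>With \<open>result\<close> and \<open>new_value\<close>, this gives the three operations
  one form: a name, and a response and new content computed from the old content. A read writes back
  what it finds. The values at \<open>Return\<close> are fillers.\<close>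

fun register :: "'v action \<Rightarrow> nat" where
  "register (Read x) = x"
| "register (Write x v) = x"
| "register (CompareSwap x old new) = x"
| "register (Return b) = 0"

fun result :: "'v action \<Rightarrow> 'v \<Rightarrow> 'v response" where
  "result (Read x) w = ReadResult w"
| "result (Write x v) w = WriteDone"
| "result (CompareSwap x old new) w = CasResult (w = old)"
| "result (Return b) w = undefined"

fun new_value :: "'v action \<Rightarrow> 'v \<Rightarrow> 'v" where
  "new_value (Read x) w = w"
| "new_value (Write x v) w = v"
| "new_value (CompareSwap x old new) w = (if w = old then new else w)"
| "new_value (Return b) w = w"

fun is_return :: "'v action \<Rightarrow> bool" where
  "is_return (Return b) = True"
| "is_return _ = False"

lemma perform_eq:
  assumes "\<not> is_return a"
  shows "perform a h R = Some (result a (R (h (register a))),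
           R(h (register a) := new_value a (R (h (register a)))))"
  using assms by (cases a) auto

lemma is_return_map [simp]: "is_return (map_action h a) = is_return a"
  by (cases a) auto

lemma register_map [simp]: "register (map_action h a) = register a"
  by (cases a) auto

text \<open>An injective renaming keeps the outcome of the test \<open>w = old\<close>. The filler
  \<open>undefined\<close> at \<open>Return\<close> need not be fixed by
  \<open>map_response h\<close>.\<close>

lemma result_map:
  assumes "inj h" "\<not> is_return a"
  shows "result (map_action h a) (h w) = map_response h (result a w)"
  using assms by (cases a) (auto dest: injD)

lemma new_value_map:
  assumes "inj h"
  shows "new_value (map_action h a) (h w) = h (new_value a w)"
  using assms by (cases a) (auto dest: injD)

section \<open>Persistence of decisions and blocks of steps\<close>

lemma step_return:
  assumes "is_return (action A (state c p))"
  shows "step A f p c = c"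
  using assms by (cases "action A (state c p)") (auto simp: step_def)

lemma step_other: "p \<noteq> q \<Longrightarrow> state (step A f p c) q = state c q"
  by (auto simp: step_def split: option.splits)

lemma returned_step:
  assumes "returned A c p b"
  shows "returned A (step A f q c) p b"
proof (cases "p = q")
  case True
  then have "step A f q c = c"
    using assms by (intro step_return) (simp add: returned_def)
  then show ?thesis using assms by simp
qed (use assms in \<open>simp add: returned_def step_other\<close>)

lemma returned_mono:
  assumes "returned A (run ident A f sched t) p b" "t \<le> t'"
  shows "returned A (run ident A f sched t') p b"
  using assms(2,1) by (induction rule: dec_induct) (auto intro: returned_step)

lemma returned_unique: "returned A c p b \<Longrightarrow> returned A c p b' \<Longrightarrow> b = b'"
  by (simp add: returned_def)

lemma fold_step_return:
  assumes "\<And>p. p \<in> set ps \<Longrightarrow> is_return (action A (state c p))"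
  shows "fold (step A f) ps c = c"
  using assms by (induction ps) (auto simp: step_return)

text \<open>Steps on distinct registers act as if performed simultaneously.\<close>

lemma fold_step_distinct:
  fixes A :: "('id, 's, 'v) algorithm"
  defines "act \<equiv> \<lambda>c p. action A (state c p)"
  assumes "distinct ps"
    and "inj_on (\<lambda>p. f p x) (set ps)"
    and "\<And>p. p \<in> set ps \<Longrightarrow> \<not> is_return (act c p) \<and> register (act c p) = x"
  defines "c' \<equiv> fold (step A f) ps c"
  shows "p \<in> set ps \<Longrightarrow> state c' p = update A (state c p) (result (act c p) (mem c (f p x)))"
    and "p \<in> set ps \<Longrightarrow> mem c' (f p x) = new_value (act c p) (mem c (f p x))"
    and "p \<notin> set ps \<Longrightarrow> state c' p = state c p"
    and "y \<notin> (\<lambda>p. f p x) ` set ps \<Longrightarrow> mem c' y = mem c y"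
proof -
  have "(\<forall>p. state (fold (step A f) ps c) p =
          (if p \<in> set ps then update A (state c p) (result (act c p) (mem c (f p x)))
           else state c p)) \<and>
        (\<forall>p\<in>set ps. mem (fold (step A f) ps c) (f p x) = new_value (act c p) (mem c (f p x))) \<and>
        (\<forall>y. y \<notin> (\<lambda>p. f p x) ` set ps \<longrightarrow> mem (fold (step A f) ps c) y = mem c y)"
    using assms(2,3,4)
  proof (induction ps rule: rev_induct)
    case (snoc q ps)
    define e where "e = fold (step A f) ps c"
    \<comment> \<open>The last process \<open>q\<close> is split off: the earlier steps have touched
      neither its state nor its register, so it acts as it would in \<open>c\<close>.\<close>
    have q: "q \<notin> set ps" "f q x \<notin> (\<lambda>p. f p x) ` set ps"
      using snoc.prems(1,2) by (auto simp: inj_on_def)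
    have IH: "\<And>p. state e p =
          (if p \<in> set ps then update A (state c p) (result (act c p) (mem c (f p x)))
           else state c p)"
        "\<And>p. p \<in> set ps \<Longrightarrow> mem e (f p x) = new_value (act c p) (mem c (f p x))"
        "\<And>y. y \<notin> (\<lambda>p. f p x) ` set ps \<Longrightarrow> mem e y = mem c y"
      using snoc unfolding e_def by (auto simp: inj_on_def)
    have "\<not> is_return (action A (state e q))" "register (action A (state e q)) = x"
      using snoc.prems(3)[of q] q IH(1)[of q] by (auto simp: act_def)
    then have "step A f q e =
        \<lparr>state = (state e)(q := update A (state c q) (result (act c q) (mem c (f q x)))),
         mem = (mem e)(f q x := new_value (act c q) (mem c (f q x)))\<rparr>"
      using q IH(1)[of q] IH(3)[of "f q x"] by (simp add: step_def perform_eq act_def)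
    moreover have "fold (step A f) (ps @ [q]) c = step A f q e"
      by (simp add: e_def)
    ultimately show ?case
      using q IH by (auto simp: image_iff)
  qed simp
  then show "p \<in> set ps \<Longrightarrow> state c' p = update A (state c p) (result (act c p) (mem c (f p x)))"
    and "p \<in> set ps \<Longrightarrow> mem c' (f p x) = new_value (act c p) (mem c (f p x))"
    and "p \<notin> set ps \<Longrightarrow> state c' p = state c p"
    and "y \<notin> (\<lambda>p. f p x) ` set ps \<Longrightarrow> mem c' y = mem c y"
    unfolding c'_def by auto
qed

lemma run_add:
  "run ident A f sched (t + j) = fold (step A f) (map sched [t..<t + j]) (run ident A f sched t)"
  by (induction j) auto

lemma round_robin: "map (\<lambda>t. t mod g + 1) [T * g..<T * g + g] = [1..<g + 1]"
  by (rule nth_equalityI) (simp_all del: upt_Suc)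

section \<open>Invariance under the cyclic symmetry\<close>

text \<open>By the laws of a group action, the inverse permutation acts as a left inverse.\<close>

lemma renaming_action_inj:
  assumes "renaming_action I ren" "\<pi> permutes I"
  shows "inj (ren \<pi>)"
proof (rule inj_on_inverseI)
  fix x
  have "ren (inv \<pi>) (ren \<pi> x) = ren (inv \<pi> \<circ> \<pi>) x"
    using assms permutes_inv[OF assms(2)] by (simp add: renaming_action_def)
  also have "\<dots> = x"
    using assms by (simp add: renaming_action_def permutes_inv_o)
  finally show "ren (inv \<pi>) (ren \<pi> x) = x" .
qed

definition invariant ::
  "nat \<Rightarrow> nat \<Rightarrow> ('s \<Rightarrow> 's) \<Rightarrow> ('v \<Rightarrow> 'v) \<Rightarrow> (nat \<Rightarrow> nat) \<Rightarrow> (nat \<Rightarrow> nat) \<Rightarrow> ('s, 'v) config \<Rightarrow> bool"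
  where
  "invariant g m rs rv \<sigma> \<tau> c \<longleftrightarrow>
     (\<forall>p\<in>{1..g}. state c (\<sigma> p) = rs (state c p)) \<and> (\<forall>y\<in>{1..m}. mem c (\<tau> y) = rv (mem c y))"

text \<open>The shift is a single cycle on \<open>{1..g}\<close>; walking from 1 up to
  \<open>p\<close> never meets the wrap-around.\<close>

lemma constant_on_cycle:
  assumes "\<And>p. p \<in> {1..g} \<Longrightarrow> F (rotation g 1 p) = F p" and "p \<in> {1..g}"
  shows "F p = F 1"
proof -
  have "Suc j \<in> {1..g} \<Longrightarrow> F (Suc j) = F 1" for j
  proof (induction j)
    case (Suc j)
    then have "rotation g 1 (Suc j) = Suc (Suc j)"
      by (simp add: rotation_def)
    then show ?case
      using Suc assms(1)[of "Suc j"] by simp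
  qed simp
  from this[of "p - 1"] show ?thesis using assms(2) by simp
qed

text \<open>Renaming leaves decisions untouched, so having returned \<open>b\<close> is constant
  along the cycle.\<close>

lemma invariant_returned:
  assumes "invariant g m rs rv (rotation g 1) \<tau> c"
    and "\<And>s. action A (rs s) = map_action rv (action A s)"
    and "returned A c 1 b" and "p \<in> {1..g}"
  shows "returned A c p b"
proof -
  let ?F = "\<lambda>p. returned A c p b"
  have "?F p = ?F 1"
  proof (rule constant_on_cycle[OF _ assms(4), of ?F])
    fix q assume "q \<in> {1..g}"
    then show "?F (rotation g 1 q) = ?F q"
      using assms(1,2) by (cases "action A (state c q)") (auto simp: invariant_def returned_def)
  qed
  then show ?thesis using assms(3) by simp
qed

text \<open>All \<open>g\<close> processes use the same register name and, by \<open>f_inj\<close>,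
  reach distinct registers. The round is thus one simultaneous step, which commutes with the
  symmetry.\<close>

lemma invariant_round:
  fixes A :: "('id, 's, 'v) algorithm"
  assumes c: "invariant g m rs rv (rotation g 1) \<tau> c"
    and act: "\<And>s. action A (rs s) = map_action rv (action A s)"
    and upd: "\<And>s r. update A (rs s) (map_response rv r) = rs (update A s r)"
    and rv: "inj rv"
    and \<tau>: "\<tau> permutes {1..m}"
    and A: "uses_registers m A"
    and f: "\<And>p. p \<in> {1..g} \<Longrightarrow> f p permutes {1..m}"
    and f_shift: "\<And>p x. p \<in> {1..g} \<Longrightarrow> f (rotation g 1 p) x = \<tau> (f p x)"
    and f_inj: "\<And>x. x \<in> {1..m} \<Longrightarrow> inj_on (\<lambda>p. f p x) {1..g}"
  shows "invariant g m rs rv (rotation g 1) \<tau> (fold (step A f) [1..<g + 1] c)"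
proof -
  let ?\<sigma> = "rotation g 1"
  define a where "a = (\<lambda>p. action A (state c p))"
  have set: "set [1..<g + 1] = {1..g}" by auto
  have \<sigma>: "?\<sigma> p \<in> {1..g}" if "p \<in> {1..g}" for p
    using that by (simp only: rotation_in)
  have a: "a (?\<sigma> p) = map_action rv (a p)" if "p \<in> {1..g}" for p
    using that c act by (simp add: a_def invariant_def)
  \<comment> \<open>Renaming changes neither whether an action is a return nor its register name, so
    both agree on the whole cycle.\<close>
  have ret: "is_return (a p) = is_return (a 1)" if "p \<in> {1..g}" for p
    using that by (rule constant_on_cycle[rotated]) (simp only: a is_return_map)
  have reg: "register (a p) = register (a 1)" if "p \<in> {1..g}" for p
    using that by (rule constant_on_cycle[rotated]) (simp only: a register_map)
  show ?thesis
  proof (cases "is_return (a 1)")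
    case True
    then have "fold (step A f) [1..<g + 1] c = c"
      using ret by (intro fold_step_return) (auto simp: a_def)
    then show ?thesis using c by simp
  next
    case False
    define x where "x = register (a 1)"
    define c' where "c' = fold (step A f) [1..<g + 1] c"
    have "register_name_ok m (a 1)"
      using A by (simp add: uses_registers_def a_def)
    then have x: "x \<in> {1..m}"
      using False unfolding x_def by (cases "a 1") auto
    have acts: "\<not> is_return (a p) \<and> register (a p) = x" if "p \<in> {1..g}" for p
      using False ret[OF that] reg[OF that] x_def by metis
    have acts': "\<not> is_return (action A (state c p)) \<and> register (action A (state c p)) = x"
      if "p \<in> {1..g}" for p
      using acts[OF that] unfolding a_def .
    note round = fold_step_distinct[of "[1..<g + 1]" f x A c, unfolded set,
        OF distinct_upt f_inj[OF x] acts']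
    have st: "state c' p = update A (state c p) (result (a p) (mem c (f p x)))"
      and mem: "mem c' (f p x) = new_value (a p) (mem c (f p x))" if "p \<in> {1..g}" for p
      using round(1,2)[OF _ that] by (simp_all only: a_def c'_def)
    have mem_other: "mem c' y = mem c y" if "y \<notin> (\<lambda>p. f p x) ` {1..g}" for y
      using round(4)[OF _ that] by (simp only: c'_def)
    \<comment> \<open>The register reached by the next process is the \<open>\<tau>\<close>-image of
      the one reached by \<open>p\<close>, so invariance of the memory relates what they
      find.\<close>
    have cell: "mem c (f (?\<sigma> p) x) = rv (mem c (f p x))" if "p \<in> {1..g}" for p
      using that c x permutes_in_image[OF f[OF that], of x]
      unfolding invariant_def f_shift[OF that] by blast
    have "state c' (?\<sigma> p) = rs (state c' p)" if p: "p \<in> {1..g}" for p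
    proof -
      have "state c (?\<sigma> p) = rs (state c p)"
        using c p by (simp add: invariant_def)
      then show ?thesis
        using st[OF p] st[OF \<sigma>[OF p]] cell[OF p] a[OF p] acts[OF p]
        by (simp add: result_map rv upd)
    qed
    moreover have "mem c' (\<tau> y) = rv (mem c' y)" if y: "y \<in> {1..m}" for y
    proof (cases "y \<in> (\<lambda>p. f p x) ` {1..g}")
      case True
      then obtain p where p: "p \<in> {1..g}" "y = f p x" by auto
      then have "mem c' (\<tau> y) = mem c' (f (?\<sigma> p) x)"
        by (simp only: f_shift)
      also have "\<dots> = rv (mem c' y)"
        using mem[OF p(1)] mem[OF \<sigma>[OF p(1)]] cell[OF p(1)] a[OF p(1)] p(2)
        by (simp add: new_value_map rv)
      finally show ?thesis .
    next
      case False
      \<comment> \<open>Since \<open>?\<sigma>\<close> maps \<open>{1..g}\<close> onto itself,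
        \<open>\<tau>\<close> also preserves the set of untouched registers.\<close>
      have "\<tau> y \<notin> (\<lambda>p. f p x) ` {1..g}"
      proof
        assume "\<tau> y \<in> (\<lambda>p. f p x) ` {1..g}"
        then obtain q where q: "q \<in> {1..g}" "\<tau> y = f q x" by auto
        obtain p where p: "p \<in> {1..g}" "q = ?\<sigma> p"
          using q(1) permutes_image[OF rotation_permutes[of g 1]] by blast
        then have "\<tau> y = \<tau> (f p x)" using q f_shift by (simp only:)
        then have "y = f p x" using permutes_inj[OF \<tau>] by (simp add: inj_eq)
        then show False using False p(1) by blast
      qed
      then show ?thesis
        using False c y by (simp add: mem_other invariant_def)
    qed
    ultimately show ?thesis
      unfolding invariant_def c'_def by simp
  qed
qed

section \<open>A symmetric execution with no leader or too many\<close>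

theorem theorem1:
  fixes n m d :: nat and ident :: "nat \<Rightarrow> 'id"
  assumes "n \<ge> 2" and "m \<ge> 1" and "d \<in> {1..n - 1}"
    and "inj_on ident {1..n}"
    and "m \<notin> M n d"
  shows "\<not> (\<exists>A :: ('id, 's, 'v) algorithm.
           uses_registers m A \<and> symmetric (ident ` {1..n}) A \<and> solves_election n m d ident A)"
proof
  assume "\<exists>A :: ('id, 's, 'v) algorithm.
           uses_registers m A \<and> symmetric (ident ` {1..n}) A \<and> solves_election n m d ident A"
  then obtain A :: "('id, 's, 'v) algorithm" where A: "uses_registers m A"
    and sym: "symmetric (ident ` {1..n}) A" and solves: "solves_election n m d ident A"
    by blast
  obtain l where l: "1 < l" "l \<le> n" "gcd l m > d"
    using assms(2,5) by (auto simp: M_def not_le)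
  define g where "g = gcd l m"
  have g: "d < g" "0 < g" "g \<le> n"
    using l le_trans[OF gcd_le1_nat[of l m]] by (auto simp: g_def)
  obtain k where m: "m = g * k"
    unfolding g_def by (meson gcd_dvd2 dvdE)
  let ?\<sigma> = "rotation g 1"
  \<comment> \<open>As \<open>m = g * k\<close>, rotating \<open>g\<close> times by \<open>k\<close>
    is a full turn, which matches the cycle of \<open>g\<close> processes.\<close>
  define \<tau> where "\<tau> = rotation m k"
  define f where "f p = rotation m (p * k)" for p
  define sched where "sched t = t mod g + 1" for t
  \<comment> \<open>Symmetry concerns permutations of all \<open>n\<close> identities, so the shift
    is extended by fixing the processes beyond \<open>g\<close>.\<close>
  have \<sigma>: "?\<sigma> permutes {1..n}"
    using g(3) by (intro permutes_subset[OF rotation_permutes]) auto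
  define \<pi> where "\<pi> = map_permutation {1..n} ident ?\<sigma>"
  have \<pi>: "\<pi> permutes ident ` {1..n}"
    unfolding \<pi>_def by (intro map_permutation_permutes inj_on_imp_bij_betw assms(4) \<sigma>)
  have \<pi>_ident: "\<pi> (ident p) = ident (?\<sigma> p)" if "p \<in> {1..n}" for p
    using that assms(4) by (simp add: \<pi>_def map_permutation_apply)
  obtain rens renv where renv: "renaming_action (ident ` {1..n}) renv"
    and default: "renv \<pi> (default_value A) = default_value A"
    and init: "\<And>i. i \<in> ident ` {1..n} \<Longrightarrow> initial A (\<pi> i) = rens \<pi> (initial A i)"
    and act: "\<And>s. action A (rens \<pi> s) = map_action (renv \<pi>) (action A s)"
    and upd: "\<And>s r. update A (rens \<pi> s) (map_response (renv \<pi>) r) = rens \<pi> (update A s r)"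
    using sym \<pi> unfolding symmetric_def by metis
  have f_shift: "f (?\<sigma> p) x = \<tau> (f p x)" if "p \<in> {1..g}" for p x
  proof (cases "p = g")
    \<comment> \<open>Process \<open>g\<close> has offset \<open>m\<close> and is followed by
      process 1: the offset \<open>k + m\<close> acts as \<open>k\<close>.\<close>
    case True
    then show ?thesis
      using rotation_add_full[of m k] g(2)
      by (simp add: f_def \<tau>_def rotation_rotation m rotation_def[of g])
  next
    case False
    then show ?thesis
      using that by (simp add: f_def \<tau>_def rotation_rotation rotation_def[of g])
  qed
  let ?run = "run ident A f sched"
  have inv: "invariant g m (rens \<pi>) (renv \<pi>) ?\<sigma> \<tau> (?run (T * g))" for T
  proof (induction T)
    case 0
    have "initial A (ident (?\<sigma> p)) = rens \<pi> (initial A (ident p))" if "p \<in> {1..g}" for p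
      using that g(3) init[of "ident p"] \<pi>_ident[of p] by simp
    then show ?case
      using default by (simp add: invariant_def init_config_def)
  next
    case (Suc T)
    have "?run (Suc T * g) = fold (step A f) [1..<g + 1] (?run (T * g))"
      using run_add[of ident A f sched "T * g" g] round_robin[of g T]
      by (simp add: sched_def[abs_def] add.commute)
    moreover have "invariant g m (rens \<pi>) (renv \<pi>) ?\<sigma> \<tau> (fold (step A f) [1..<g + 1] (?run (T * g)))"
    proof (rule invariant_round[OF Suc act upd renaming_action_inj[OF renv \<pi>]])
      show "inj_on (\<lambda>p. f p x) {1..g}" if "x \<in> {1..m}" for x
        using that inj_on_rotation_multiples unfolding f_def m by blast
      show "f p permutes {1..m}" for p
        by (simp only: f_def rotation_permutes)
      show "\<tau> permutes {1..m}"
        by (simp only: \<tau>_def rotation_permutes)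
    qed (use A f_shift in blast)+
    ultimately show ?case by simp
  qed
  have "execution ident A {1..g} f sched"
  proof -
    have "\<exists>t'\<ge>t. sched t' = p" if "p \<in> {1..g}" for p t
    proof (intro exI conjI)
      \<comment> \<open>The slot of \<open>p\<close> in round \<open>t\<close> comes no earlier than
        time \<open>t\<close>.\<close>
      have "t \<le> t * g" using g(2) by simp
      then show "t \<le> t * g + (p - 1)" by linarith
      have "p - 1 < g" using that by auto
      then show "sched (t * g + (p - 1)) = p"
        using that by (simp add: sched_def del: add_diff_assoc)
    qed
    then show ?thesis
      using g(2) by (auto simp: execution_def sched_def Suc_le_eq)
  qed
  moreover have "\<forall>p\<in>{1..n}. f p permutes {1..m}"
    by (auto simp only: f_def rotation_permutes)
  moreover have "{1..g} \<noteq> {}" "{1..g} \<subseteq> {1..n}"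
    using g by auto
  ultimately have returns: "\<forall>p\<in>{1..g}. \<exists>t b. returned A (?run t) p b"
    and card: "1 \<le> card (elected ident A {1..g} f sched)" "card (elected ident A {1..g} f sched) \<le> d"
    using solves unfolding solves_election_def by blast+
  obtain t b where "returned A (?run t) 1 b"
    using returns g(2) by fastforce
  \<comment> \<open>Invariance holds only between rounds, so the decision is carried on to the end
    of a round.\<close>
  then have "returned A (?run (t * g)) 1 b"
    by (rule returned_mono) (use g(2) in simp)
  then have all: "returned A (?run (t * g)) p b" if "p \<in> {1..g}" for p
    using invariant_returned[OF inv act] that by blast
  show False
  proof (cases b)
    case Leader
    then have "elected ident A {1..g} f sched = {1..g}"
      using all unfolding elected_def by blast
    then show False using card(2) g(1) by simp
  next
    case NotLeader
    from card(1) obtain p where "p \<in> elected ident A {1..g} f sched"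
      by (metis card.empty ex_in_conv not_one_le_zero)
    then obtain t' where p: "p \<in> {1..g}" "returned A (?run t') p Leader"
      by (auto simp: elected_def)
    \<comment> \<open>The two conflicting decisions of \<open>p\<close> are brought to a common
      later time.\<close>
    have "returned A (?run (max (t * g) t')) p Leader"
      "returned A (?run (max (t * g) t')) p NotLeader"
      using returned_mono[OF p(2)] returned_mono[OF all[OF p(1)]] NotLeader by simp_all
    then show False
      using returned_unique by blast
  qed
qed

end
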